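(* Let $U_1,U_2$ be two complete ultrametric spaces. Then $U_1$ and $U_2$ are uniformly homeomorphic if and only if there is a common zig-zag $D_-$-chain of their associated $D_-$-chains.
   Context: $\mathbb N=\{1,2,\dots\}$. An ultrametric space is a metric space $(X,d)$ with $d(x,y)\le\max\{d(x,z),d(z,y)\}$ for all $x,y,z$. Two metric spaces are uniformly homeomorphic if there is a bijection between them that is uniformly continuous with uniformly continuous inverse. $D_-$-chain: a sequence of sets $X_n$ ($n\in\mathbb N$) and surjective maps $\Phi_n\colon X_{n+1}\to X_n$. Subchain: for a (strictly) increasing $\alpha\colon\mathbb N\to\mathbb N$, the $\alpha$-subchain is $(X_{\alpha(n)},\tilde\Phi_n)$ with $\tilde\Phi_n=\Phi_{\alpha(n)}\circ\cdots\circ\Phi_{\alpha(n+1)-1}\colon X_{\alpha(n+1)}\to X_{\alpha(n)}$. Common zig-zag $D_-$-chain: a $D_-$-chain $(Z_n,\mathcal V_n)$ is a common zig-zag $D_-$-chain of $D_-$-chains $(X_n,\Phi_n)$ and $(Y_n,\Psi_n)$ if there are increasing $\alpha,\beta\colon\mathbb N\to\mathbb N$ such that $Z_{2n-1}=X_{\alpha(n)}$, $Z_{2n}=Y_{\beta(n)}$ for all $n\ge1$ (so $\mathcal V_{2n-1}\colon Y_{\beta(n)}\to X_{\alpha(n)}$ and $\mathcal V_{2n}\colon X_{\alpha(n+1)}\to Y_{\beta(n)}$), and $\mathcal V_{2n-1}\circ\mathcal V_{2n}=\tilde\Phi_n$, $\mathcal V_{2n}\circ\mathcal V_{2n+1}=\tilde\Psi_n$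 for all $n$, where $(X_{\alpha(n)},\tilde\Phi_n)$ and $(Y_{\beta(n)},\tilde\Psi_n)$ are the corresponding subchains. Associated $D_-$-chain of an ultrametric space $U$: for $n\in\mathbb N$, $X_n$ is the partition of $U$ into closed balls of radius $2^{-n}$, and $\Phi_n\colon X_{n+1}\to X_n$ sends a ball to the ball of radius $2^{-n}$ containing it. *)

theory Defs
  imports "HOL-Analysis.Analysis"
begin

definition ultrametric :: "'a metric \<Rightarrow> bool" where
  "ultrametric U \<longleftrightarrow>
     (\<forall>x\<in>mspace U. \<forall>y\<in>mspace U. \<forall>z\<in>mspace U.
        mdist U x y \<le> max (mdist U x z) (mdist U z y))"

definition uniformly_homeomorphic :: "'a metric \<Rightarrow> 'b metric \<Rightarrow> bool" where
  "uniformly_homeomorphic U1 U2 \<longleftrightarrow>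
     (\<exists>f. bij_betw f (mspace U1) (mspace U2) \<and>
          uniformly_continuous_map U1 U2 f \<and>
          uniformly_continuous_map U2 U1 (inv_into (mspace U1) f))"

text \<open>
  A chain is a pair of sequences \<open>X\<close>, \<open>\<Phi>\<close>, indexed by the positive integers: the values
  at index \<open>0\<close>, and the values of \<open>\<Phi> n\<close> outside \<open>X (Suc n)\<close>, are irrelevant.
\<close>

definition D_minus_chain :: "(nat \<Rightarrow> 'a set) \<Rightarrow> (nat \<Rightarrow> 'a \<Rightarrow> 'a) \<Rightarrow> bool" where
  "D_minus_chain X \<Phi> \<longleftrightarrow> (\<forall>n\<ge>1. \<Phi> n ` X (Suc n) = X n)"

definition increasing_index :: "(nat \<Rightarrow> nat) \<Rightarrow> bool" where
  "increasing_index \<alpha> \<longleftrightarrow> \<alpha> \<in> {1..} \<rightarrow> {1..} \<and> strict_mono_on {1..} \<alpha>"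

definition subchain_set :: "(nat \<Rightarrow> nat) \<Rightarrow> (nat \<Rightarrow> 'a set) \<Rightarrow> nat \<Rightarrow> 'a set" where
  "subchain_set \<alpha> X n = X (\<alpha> n)"

text \<open>The composition \<open>\<Phi> (\<alpha> n) \<circ> \<dots> \<circ> \<Phi> (\<alpha> (n + 1) - 1)\<close>.\<close>

definition subchain_map :: "(nat \<Rightarrow> nat) \<Rightarrow> (nat \<Rightarrow> 'a \<Rightarrow> 'a) \<Rightarrow> nat \<Rightarrow> 'a \<Rightarrow> 'a" where
  "subchain_map \<alpha> \<Phi> n = foldr (\<circ>) (map \<Phi> [\<alpha> n..<\<alpha> (Suc n)]) id"

text \<open>
  The sets \<open>X n\<close> and \<open>Y n\<close> live in different types, so the zig-zag chain lives in the sum type,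
  with \<open>X (\<alpha> n)\<close> and \<open>Y (\<beta> n)\<close> represented by their images under \<open>Inl\<close> and \<open>Inr\<close>.
\<close>

definition common_zigzag ::
  "(nat \<Rightarrow> ('a + 'b) set) \<Rightarrow> (nat \<Rightarrow> 'a + 'b \<Rightarrow> 'a + 'b) \<Rightarrow>
   (nat \<Rightarrow> 'a set) \<Rightarrow> (nat \<Rightarrow> 'a \<Rightarrow> 'a) \<Rightarrow>
   (nat \<Rightarrow> 'b set) \<Rightarrow> (nat \<Rightarrow> 'b \<Rightarrow> 'b) \<Rightarrow> bool" where
  "common_zigzag Z V X \<Phi> Y \<Psi> \<longleftrightarrow>
     D_minus_chain Z V \<and>
     (\<exists>\<alpha> \<beta>. increasing_index \<alpha> \<and> increasing_index \<beta> \<and>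
        (\<forall>n\<ge>1. Z (2 * n - 1) = Inl ` subchain_set \<alpha> X n \<and>
               Z (2 * n) = Inr ` subchain_set \<beta> Y n) \<and>
        (\<forall>n\<ge>1. \<forall>x\<in>subchain_set \<alpha> X (Suc n).
           V (2 * n - 1) (V (2 * n) (Inl x)) = Inl (subchain_map \<alpha> \<Phi> n x)) \<and>
        (\<forall>n\<ge>1. \<forall>y\<in>subchain_set \<beta> Y (Suc n).
           V (2 * n) (V (2 * n + 1) (Inr y)) = Inr (subchain_map \<beta> \<Psi> n y)))"

definition assoc_set :: "'a metric \<Rightarrow> nat \<Rightarrow> 'a set set" where
  "assoc_set U n = (\<lambda>x. mcball_of U x (1 / 2 ^ n)) ` mspace U"

definition assoc_map :: "'a metric \<Rightarrow> nat \<Rightarrow> 'a set \<Rightarrow> 'a set" where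
  "assoc_map U n B = (THE C. C \<in> assoc_set U n \<and> B \<subseteq> C)"

lemma ultrametric_mcball_eq:
  assumes "ultrametric U" "x \<in> mspace U" "y \<in> mcball_of U x r"
  shows "mcball_of U y r = mcball_of U x r"
proof -
  have y: "y \<in> mspace U" "mdist U x y \<le> r" "mdist U y x \<le> r"
    using assms(3) by (auto simp: mdist_commute)
  have "mdist U x z \<le> r \<longleftrightarrow> mdist U y z \<le> r" if "z \<in> mspace U" for z
    using assms(1,2) y that unfolding ultrametric_def by (meson max.bounded_iff order_trans max.boundedI)
  then show ?thesis
    using assms(2) y(1) by auto
qed

lemma assoc_map_mcball:
  assumes "ultrametric U" "x \<in> mspace U"
  shows "assoc_map U n (mcball_of U x (1 / 2 ^ Suc n)) = mcball_of U x (1 / 2 ^ n)"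
  unfolding assoc_map_def
proof (rule the_equality)
  have "1 / 2 ^ Suc n \<le> (1 / 2 ^ n :: real)"
    by (simp add: field_simps)
  then have "mcball_of U x (1 / 2 ^ Suc n) \<subseteq> mcball_of U x (1 / 2 ^ n)"
    by (meson in_mcball_of order_trans subsetI)
  then show "mcball_of U x (1 / 2 ^ n) \<in> assoc_set U n \<and>
             mcball_of U x (1 / 2 ^ Suc n) \<subseteq> mcball_of U x (1 / 2 ^ n)"
    using assms(2) by (simp add: assoc_set_def)
next
  fix C
  assume C: "C \<in> assoc_set U n \<and> mcball_of U x (1 / 2 ^ Suc n) \<subseteq> C"
  then obtain c where c: "c \<in> mspace U" "C = mcball_of U c (1 / 2 ^ n)"
    by (auto simp: assoc_set_def)
  have "x \<in> mcball_of U x (1 / 2 ^ Suc n)"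
    by (simp add: assms(2) mdist_zero[THEN iffD2, OF assms(2) assms(2) refl])
  then show "C = mcball_of U x (1 / 2 ^ n)"
    using C c ultrametric_mcball_eq[OF assms(1) c(1)] by blast
qed

lemma D_minus_chain_assoc:
  assumes "ultrametric U"
  shows "D_minus_chain (assoc_set U) (assoc_map U)"
  using assoc_map_mcball[OF assms]
  unfolding D_minus_chain_def assoc_set_def image_image by (auto intro!: image_cong simp del: power_Suc)

end

theory Submission
  imports Defs
begin

text \<open>
  Up to uniform homeomorphism, a complete ultrametric space can be recovered from its chain of
  partitions into balls of radius \<open>2\<^sup>-\<^sup>n\<close>: by completeness its points are exactly the nested sequences of
  balls, one from each partition. A uniformly continuous map induces, for every target level \<open>n\<close>,
  a map of partitions from some finer level \<open>m\<close> to level \<open>n\<close>, because two points of one ball of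
  level \<open>m\<close> have images in one ball of level \<open>n\<close> (\<open>uniformly_continuous_map_iff_dyball\<close>).

  Given a uniform homeomorphism, one can pick levels \<open>\<gamma> 1 < \<gamma> 2 < \<dots>\<close> so fast that both the map and
  its inverse carry balls of level \<open>\<gamma> (k + 1)\<close> into balls of level \<open>\<gamma> k\<close>. Alternating between the
  two spaces along \<open>\<gamma>\<close> gives the zig-zag chain. A composite of two consecutive maps sends the ball
  of \<open>x\<close> to the coarser ball of \<open>x\<close>, as the two point maps cancel, and this is what the subchain
  maps do (\<open>subchain_map_dyball\<close>).

  Conversely, the maps of a zig-zag chain that go from one space to the other send the balls around
  a point \<open>x\<close> to balls of the other space. The zig-zag equations make these images nested, so they
  shrink to a point \<open>f x\<close>, and \<open>f\<close> is uniformly continuous because each ball around \<open>f x\<close> depends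
  only on a ball around \<open>x\<close> (\<open>ball_maps_induce_point_map\<close>). Both directions of the zig-zag yield
  such a point map, and the zig-zag equations say that these two maps are inverse to each other.
\<close>

section \<open>Dyadic balls of an ultrametric space\<close>

definition dyball :: "'a metric \<Rightarrow> nat \<Rightarrow> 'a \<Rightarrow> 'a set" where
  "dyball U n x = mcball_of U x (1 / 2 ^ n)"

lemma assoc_set_eq_dyball: "assoc_set U n = dyball U n ` mspace U"
  by (simp add: assoc_set_def dyball_def)

lemma mem_dyball_self: "x \<in> mspace U \<Longrightarrow> x \<in> dyball U n x"
  by (simp add: dyball_def mdist_zero[THEN iffD2])

lemma dyball_antimono: "m \<le> n \<Longrightarrow> dyball U n x \<subseteq> dyball U m x"
proof -
  assume "m \<le> n"
  then have "1 / 2 ^ n \<le> (1 / 2 ^ m :: real)"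
    by (simp add: frac_le)
  then show ?thesis
    unfolding dyball_def by (meson in_mcball_of order_trans subsetI)
qed

lemma dyball_eq_if_mem:
  assumes "ultrametric U" "x \<in> mspace U" "y \<in> dyball U n x"
  shows "dyball U n y = dyball U n x"
  using ultrametric_mcball_eq[OF assms(1,2)] assms(3) unfolding dyball_def .

lemma dyball_eq_iff:
  assumes "ultrametric U" "x \<in> mspace U" "y \<in> mspace U"
  shows "dyball U n x = dyball U n y \<longleftrightarrow> mdist U x y \<le> 1 / 2 ^ n"
proof
  assume "dyball U n x = dyball U n y"
  then show "mdist U x y \<le> 1 / 2 ^ n"
    using mem_dyball_self[OF assms(3), of n] by (auto simp: dyball_def)
next
  assume "mdist U x y \<le> 1 / 2 ^ n"
  then have "y \<in> dyball U n x"
    using assms by (simp add: dyball_def)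
  then show "dyball U n x = dyball U n y"
    using dyball_eq_if_mem[OF assms(1,2)] by blast
qed

lemma dyball_eq_coarser:
  assumes "ultrametric U" "x \<in> mspace U" "y \<in> mspace U"
    and "dyball U n x = dyball U n y" "m \<le> n"
  shows "dyball U m x = dyball U m y"
proof -
  have "y \<in> dyball U m x"
    using mem_dyball_self[OF assms(3), of n] unfolding assms(4)[symmetric]
    by (rule subsetD[OF dyball_antimono[OF assms(5)]])
  then show ?thesis
    using dyball_eq_if_mem[OF assms(1,2)] by simp
qed

lemma increasing_index_ge:
  assumes "increasing_index \<alpha>" "n \<ge> 1"
  shows "n \<le> \<alpha> n"
  using assms(2)
proof (induction n rule: dec_induct)
  case base
  then show ?case using assms(1) by (auto simp: increasing_index_def)
next
  case (step n)
  then have "\<alpha> n < \<alpha> (Suc n)"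
    using assms(1) by (auto simp: increasing_index_def strict_mono_on_def)
  with step show ?case by simp
qed

lemma increasing_index_Suc_le:
  assumes "increasing_index \<alpha>" "n \<ge> 1"
  shows "\<alpha> n \<le> \<alpha> (Suc n)"
  using assms by (auto simp: increasing_index_def strict_mono_on_def intro: less_imp_le)

lemma exists_dyadic_less:
  assumes "(e::real) > 0"
  obtains n where "n \<ge> 1" "\<And>m. m \<ge> n \<Longrightarrow> 1 / 2 ^ m < e"
proof -
  obtain k where k: "(1/2::real) ^ k < e"
    using real_arch_pow_inv[OF assms, of "1/2"] by auto
  have "1 / 2 ^ m < e" if "m \<ge> Suc k" for m
  proof -
    have "(1/2::real) ^ m \<le> (1/2) ^ k"
      using that by (intro power_decreasing) auto
    with k show ?thesis by (simp add: power_one_over)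
  qed
  then show ?thesis using that[of "Suc k"] by simp
qed

text \<open>The levels \<open>\<alpha> n\<close> are unbounded, so the radii of the balls tend to 0.\<close>

lemma eq_if_dyballs_eq:
  assumes "ultrametric U" "increasing_index \<alpha>" "x \<in> mspace U" "y \<in> mspace U"
    and eq: "\<And>n. n \<ge> 1 \<Longrightarrow> dyball U (\<alpha> n) x = dyball U (\<alpha> n) y"
  shows "x = y"
proof (rule ccontr)
  assume "x \<noteq> y"
  then have "mdist U x y > 0"
    using assms(3,4) by (metis mdist_nonneg mdist_zero order_le_less)
  then obtain n where n: "n \<ge> 1" "\<And>m. m \<ge> n \<Longrightarrow> 1 / 2 ^ m < mdist U x y"
    using exists_dyadic_less by blast
  have "mdist U x y \<le> 1 / 2 ^ \<alpha> n"
    using eq[OF n(1)] dyball_eq_iff[OF assms(1,3,4)] by blast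
  with n(2)[OF increasing_index_ge[OF assms(2) n(1)]] show False by linarith
qed

text \<open>
  In an ultrametric space, having distance at most \<open>1 / 2 ^ n\<close> is an equivalence relation whose classes
  are the balls of level \<open>n\<close>. Uniform continuity thus becomes a statement about partitions.
\<close>

lemma uniformly_continuous_map_iff_dyball:
  assumes "ultrametric U1" "ultrametric U2" and f: "f \<in> mspace U1 \<rightarrow> mspace U2"
  shows "uniformly_continuous_map U1 U2 f \<longleftrightarrow>
    (\<forall>n. \<exists>m. \<forall>x\<in>mspace U1. \<forall>y\<in>mspace U1.
       dyball U1 m x = dyball U1 m y \<longrightarrow> dyball U2 n (f x) = dyball U2 n (f y))"
    (is "_ \<longleftrightarrow> ?R")
proof
  assume uc: "uniformly_continuous_map U1 U2 f"
  show ?R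
  proof
    fix n :: nat
    have "(1 / 2 ^ n :: real) > 0" by simp
    then obtain d where d: "d > 0"
      "\<And>x y. x \<in> mspace U1 \<Longrightarrow> y \<in> mspace U1 \<Longrightarrow> mdist U1 y x < d \<Longrightarrow> mdist U2 (f y) (f x) < 1 / 2 ^ n"
      using uc unfolding uniformly_continuous_map_def by blast
    obtain m where "\<And>k. k \<ge> m \<Longrightarrow> 1 / 2 ^ k < d"
      using exists_dyadic_less[OF d(1)] by blast
    then have m: "1 / 2 ^ m < d" by simp
    have "dyball U2 n (f x) = dyball U2 n (f y)"
      if "x \<in> mspace U1" "y \<in> mspace U1" "dyball U1 m x = dyball U1 m y" for x y
    proof -
      have "mdist U1 x y < d"
        using dyball_eq_iff[OF assms(1) that(1,2)] that(3) m by fastforce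
      then have "mdist U2 (f x) (f y) \<le> 1 / 2 ^ n"
        using d(2) that by (simp add: less_imp_le)
      moreover have "f x \<in> mspace U2" "f y \<in> mspace U2"
        using f that by auto
      ultimately show ?thesis
        using dyball_eq_iff[OF assms(2)] by blast
    qed
    then show "\<exists>m. \<forall>x\<in>mspace U1. \<forall>y\<in>mspace U1.
        dyball U1 m x = dyball U1 m y \<longrightarrow> dyball U2 n (f x) = dyball U2 n (f y)"
      by blast
  qed
next
  assume R: ?R
  show "uniformly_continuous_map U1 U2 f"
    unfolding uniformly_continuous_map_def
  proof (intro conjI allI impI f)
    fix e :: real
    assume "e > 0"
    then obtain n where "\<And>k. k \<ge> n \<Longrightarrow> 1 / 2 ^ k < e"
      using exists_dyadic_less by blast
    then have n: "1 / 2 ^ n < e" by simp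
    obtain m where m: "\<forall>x\<in>mspace U1. \<forall>y\<in>mspace U1.
        dyball U1 m x = dyball U1 m y \<longrightarrow> dyball U2 n (f x) = dyball U2 n (f y)"
      using R[THEN spec, of n] by (elim exE)
    have "mdist U2 (f y) (f x) < e"
      if "x \<in> mspace U1" "y \<in> mspace U1" "mdist U1 y x < 1 / 2 ^ m" for x y
    proof -
      have "dyball U1 m y = dyball U1 m x"
        using dyball_eq_iff[OF assms(1) that(2,1)] that(3) by simp
      then have "dyball U2 n (f y) = dyball U2 n (f x)"
        using m that(1,2) by blast
      moreover have "f x \<in> mspace U2" "f y \<in> mspace U2"
        using f that by auto
      ultimately show ?thesis
        using dyball_eq_iff[OF assms(2)] n by fastforce
    qed
    then show "\<exists>\<delta>>0. \<forall>x\<in>mspace U1. \<forall>y\<in>mspace U1. mdist U1 y x < \<delta> \<longrightarrow> mdist U2 (f y) (f x) < e"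
      by (intro exI[of _ "1 / 2 ^ m"]) simp
  qed
qed

lemma subchain_map_dyball:
  assumes "ultrametric U" "x \<in> mspace U" "\<alpha> n \<le> \<alpha> (Suc n)"
  shows "subchain_map \<alpha> (assoc_map U) n (dyball U (\<alpha> (Suc n)) x) = dyball U (\<alpha> n) x"
proof -
  have "foldr (\<circ>) (map (assoc_map U) [i..<j]) id (dyball U j x) = dyball U i x" if "i \<le> j" for i j
    using that
  proof (induction i rule: inc_induct)
    case (step i)
    have "assoc_map U i (dyball U (Suc i) x) = dyball U i x"
      using assoc_map_mcball[OF assms(1,2)] unfolding dyball_def .
    with step show ?case by (simp add: upt_conv_Cons)
  qed simp
  with assms(3) show ?thesis by (simp add: subchain_map_def)
qed

section \<open>From a uniform homeomorphism to a zig-zag chain\<close>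

text \<open>
  One sequence of levels serves both directions: at each step the next level is finer than what
  uniform continuity of either map asks for.
\<close>

lemma common_modulus_levels:
  assumes u: "ultrametric U1" "ultrametric U2"
    and f: "uniformly_continuous_map U1 U2 f" and g: "uniformly_continuous_map U2 U1 g"
  obtains \<gamma> :: "nat \<Rightarrow> nat" where "strict_mono \<gamma>"
    "\<And>k x y. x \<in> mspace U1 \<Longrightarrow> y \<in> mspace U1 \<Longrightarrow>
       dyball U1 (\<gamma> (Suc k)) x = dyball U1 (\<gamma> (Suc k)) y \<Longrightarrow> dyball U2 (\<gamma> k) (f x) = dyball U2 (\<gamma> k) (f y)"
    "\<And>k x y. x \<in> mspace U2 \<Longrightarrow> y \<in> mspace U2 \<Longrightarrow>
       dyball U2 (\<gamma> (Suc k)) x = dyball U2 (\<gamma> (Suc k)) y \<Longrightarrow> dyball U1 (\<gamma> k) (g x) = dyball U1 (\<gamma> k) (g y)"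
proof -
  have "f \<in> mspace U1 \<rightarrow> mspace U2" "g \<in> mspace U2 \<rightarrow> mspace U1"
    using f g by (auto simp: uniformly_continuous_map_def)
  note uc = uniformly_continuous_map_iff_dyball[OF u this(1), THEN iffD1, OF f]
    uniformly_continuous_map_iff_dyball[OF u(2,1) this(2), THEN iffD1, OF g]
  obtain p where p: "\<And>n x y. x \<in> mspace U1 \<Longrightarrow> y \<in> mspace U1 \<Longrightarrow>
      dyball U1 (p n) x = dyball U1 (p n) y \<Longrightarrow> dyball U2 n (f x) = dyball U2 n (f y)"
    using uc(1) by metis
  obtain q where q: "\<And>n x y. x \<in> mspace U2 \<Longrightarrow> y \<in> mspace U2 \<Longrightarrow>
      dyball U2 (q n) x = dyball U2 (q n) y \<Longrightarrow> dyball U1 n (g x) = dyball U1 n (g y)"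
    using uc(2) by metis
  define r where "r n = Suc n + p n + q n" for n
  define \<gamma> where "\<gamma> k = (r ^^ k) 0" for k
  have \<gamma>: "\<gamma> (Suc k) = r (\<gamma> k)" for k
    by (simp add: \<gamma>_def)
  have le: "p (\<gamma> k) \<le> \<gamma> (Suc k)" "q (\<gamma> k) \<le> \<gamma> (Suc k)" for k
    by (simp_all add: \<gamma> r_def)
  show thesis
  proof (rule that[of \<gamma>])
    show "strict_mono \<gamma>"
      by (simp add: strict_mono_Suc_iff \<gamma> r_def)
  next
    fix k x y
    assume "x \<in> mspace U1" "y \<in> mspace U1" "dyball U1 (\<gamma> (Suc k)) x = dyball U1 (\<gamma> (Suc k)) y"
    then show "dyball U2 (\<gamma> k) (f x) = dyball U2 (\<gamma> k) (f y)"
      using p dyball_eq_coarser[OF u(1) _ _ _ le(1)] by metis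
  next
    fix k x y
    assume "x \<in> mspace U2" "y \<in> mspace U2" "dyball U2 (\<gamma> (Suc k)) x = dyball U2 (\<gamma> (Suc k)) y"
    then show "dyball U1 (\<gamma> k) (g x) = dyball U1 (\<gamma> k) (g y)"
      using q dyball_eq_coarser[OF u(2) _ _ _ le(2)] by metis
  qed
qed

lemma common_zigzag_if_uniformly_homeomorphic:
  fixes U1 :: "'a metric" and U2 :: "'b metric"
  assumes u: "ultrametric U1" "ultrametric U2" and h: "uniformly_homeomorphic U1 U2"
  shows "\<exists>Z V. common_zigzag Z V (assoc_set U1) (assoc_map U1) (assoc_set U2) (assoc_map U2)"
proof -
  obtain f where f: "bij_betw f (mspace U1) (mspace U2)" "uniformly_continuous_map U1 U2 f"
    "uniformly_continuous_map U2 U1 (inv_into (mspace U1) f)"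
    using h by (auto simp: uniformly_homeomorphic_def)
  define g where "g = inv_into (mspace U1) f"
  have f_im: "f ` mspace U1 = mspace U2" and g_im: "g ` mspace U2 = mspace U1"
    using f(1) bij_betw_inv_into[OF f(1)] by (auto simp: g_def bij_betw_def)
  have f_in: "f x \<in> mspace U2" if "x \<in> mspace U1" for x
    using that f_im by auto
  have g_in: "g y \<in> mspace U1" if "y \<in> mspace U2" for y
    using that g_im by auto
  have gf: "g (f x) = x" if "x \<in> mspace U1" for x
    using bij_betw_inv_into_left[OF f(1) that] by (simp add: g_def)
  have fg: "f (g y) = y" if "y \<in> mspace U2" for y
    using bij_betw_inv_into_right[OF f(1) that] by (simp add: g_def)
  obtain \<gamma> :: "nat \<Rightarrow> nat" where \<gamma>: "strict_mono \<gamma>"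
    and \<gamma>f: "\<And>k x y. x \<in> mspace U1 \<Longrightarrow> y \<in> mspace U1 \<Longrightarrow>
       dyball U1 (\<gamma> (Suc k)) x = dyball U1 (\<gamma> (Suc k)) y \<Longrightarrow> dyball U2 (\<gamma> k) (f x) = dyball U2 (\<gamma> k) (f y)"
    and \<gamma>g: "\<And>k x y. x \<in> mspace U2 \<Longrightarrow> y \<in> mspace U2 \<Longrightarrow>
       dyball U2 (\<gamma> (Suc k)) x = dyball U2 (\<gamma> (Suc k)) y \<Longrightarrow> dyball U1 (\<gamma> k) (g x) = dyball U1 (\<gamma> k) (g y)"
    using common_modulus_levels[OF u f(2,3)] unfolding g_def by metis
  define \<alpha> where "\<alpha> n = \<gamma> (2 * n - 1)" for n
  define \<beta> where "\<beta> n = \<gamma> (2 * n)" for n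
  define Z :: "nat \<Rightarrow> ('a set + 'b set) set" where
    "Z k = (if odd k then Inl ` assoc_set U1 (\<gamma> k) else Inr ` assoc_set U2 (\<gamma> k))" for k
  define V :: "nat \<Rightarrow> 'a set + 'b set \<Rightarrow> 'a set + 'b set" where
    "V k z = (case z of Inl B \<Rightarrow> Inr (dyball U2 (\<gamma> k) (f (SOME x. x \<in> B)))
                      | Inr B \<Rightarrow> Inl (dyball U1 (\<gamma> k) (g (SOME y. y \<in> B))))" for k z
  \<comment> \<open>The choice of a point in the ball is immaterial at the next coarser level.\<close>
  have VL: "V k (Inl (dyball U1 (\<gamma> (Suc k)) x)) = Inr (dyball U2 (\<gamma> k) (f x))"
    if x: "x \<in> mspace U1" for k x
  proof -
    define s where "s = (SOME s. s \<in> dyball U1 (\<gamma> (Suc k)) x)"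
    have "s \<in> dyball U1 (\<gamma> (Suc k)) x"
      unfolding s_def using mem_dyball_self[OF x] by (rule someI)
    moreover from this have "s \<in> mspace U1"
      by (simp add: dyball_def)
    ultimately have "dyball U2 (\<gamma> k) (f s) = dyball U2 (\<gamma> k) (f x)"
      using \<gamma>f x dyball_eq_if_mem[OF u(1) x] by blast
    then show ?thesis by (simp add: V_def s_def)
  qed
  have VR: "V k (Inr (dyball U2 (\<gamma> (Suc k)) y)) = Inl (dyball U1 (\<gamma> k) (g y))"
    if y: "y \<in> mspace U2" for k y
  proof -
    define s where "s = (SOME s. s \<in> dyball U2 (\<gamma> (Suc k)) y)"
    have "s \<in> dyball U2 (\<gamma> (Suc k)) y"
      unfolding s_def using mem_dyball_self[OF y] by (rule someI)
    moreover from this have "s \<in> mspace U2"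
      by (simp add: dyball_def)
    ultimately have "dyball U1 (\<gamma> k) (g s) = dyball U1 (\<gamma> k) (g y)"
      using \<gamma>g y dyball_eq_if_mem[OF u(2) y] by blast
    then show ?thesis by (simp add: V_def s_def)
  qed
  have ZV: "V k ` Z (Suc k) = Z k" for k
  proof (cases "odd k")
    case True
    then have "V k ` Z (Suc k) = (\<lambda>y. Inl (dyball U1 (\<gamma> k) (g y))) ` mspace U2"
      unfolding Z_def by (simp add: assoc_set_eq_dyball image_image VR)
    also have "\<dots> = (\<lambda>x. Inl (dyball U1 (\<gamma> k) x)) ` g ` mspace U2"
      by (simp add: image_image)
    finally show ?thesis
      using True by (simp add: Z_def g_im assoc_set_eq_dyball image_image)
  next
    case False
    then have "V k ` Z (Suc k) = (\<lambda>x. Inr (dyball U2 (\<gamma> k) (f x))) ` mspace U1"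
      unfolding Z_def by (simp add: assoc_set_eq_dyball image_image VL)
    also have "\<dots> = (\<lambda>y. Inr (dyball U2 (\<gamma> k) y)) ` f ` mspace U1"
      by (simp add: image_image)
    finally show ?thesis
      using False by (simp add: Z_def f_im assoc_set_eq_dyball image_image)
  qed
  have \<gamma>_pos: "\<gamma> k \<ge> 1" if "k \<ge> 1" for k
    using seq_suble[OF \<gamma>, of k] that by simp
  have \<alpha>: "increasing_index \<alpha>" and \<beta>: "increasing_index \<beta>"
    using \<gamma>_pos strict_monoD[OF \<gamma>]
    by (auto simp: increasing_index_def \<alpha>_def \<beta>_def strict_mono_on_def Suc_le_eq)
  have 1: "V (2 * n - 1) (V (2 * n) (Inl B)) = Inl (subchain_map \<alpha> (assoc_map U1) n B)"
    if n: "n \<ge> 1" and B: "B \<in> subchain_set \<alpha> (assoc_set U1) (Suc n)" for n B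
  proof -
    obtain x where x: "x \<in> mspace U1" "B = dyball U1 (\<alpha> (Suc n)) x"
      using B by (auto simp: subchain_set_def assoc_set_eq_dyball)
    have "Suc (2 * n - 1) = 2 * n"
      using n by simp
    then have "V (2 * n - 1) (V (2 * n) (Inl B)) = Inl (dyball U1 (\<alpha> n) x)"
      using VL[OF x(1), of "2 * n"] VR[OF f_in[OF x(1)], of "2 * n - 1"] gf[OF x(1)]
      by (simp add: x(2) \<alpha>_def)
    then show ?thesis
      using subchain_map_dyball[OF u(1) x(1), of \<alpha>] increasing_index_Suc_le[OF \<alpha> n] x(2) by simp
  qed
  have 2: "V (2 * n) (V (2 * n + 1) (Inr B)) = Inr (subchain_map \<beta> (assoc_map U2) n B)"
    if n: "n \<ge> 1" and B: "B \<in> subchain_set \<beta> (assoc_set U2) (Suc n)" for n B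
  proof -
    obtain y where y: "y \<in> mspace U2" "B = dyball U2 (\<beta> (Suc n)) y"
      using B by (auto simp: subchain_set_def assoc_set_eq_dyball)
    have "V (2 * n) (V (2 * n + 1) (Inr B)) = Inr (dyball U2 (\<beta> n) y)"
      using VR[OF y(1), of "2 * n + 1"] VL[OF g_in[OF y(1)], of "2 * n"] fg[OF y(1)]
      by (simp add: y(2) \<beta>_def)
    then show ?thesis
      using subchain_map_dyball[OF u(2) y(1), of \<beta>] increasing_index_Suc_le[OF \<beta> n] y(2) by simp
  qed
  have 3: "Z (2 * n - 1) = Inl ` subchain_set \<alpha> (assoc_set U1) n \<and>
           Z (2 * n) = Inr ` subchain_set \<beta> (assoc_set U2) n" if "n \<ge> 1" for n
    using that by (simp add: Z_def subchain_set_def \<alpha>_def \<beta>_def)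
  have "common_zigzag Z V (assoc_set U1) (assoc_map U1) (assoc_set U2) (assoc_map U2)"
    unfolding common_zigzag_def D_minus_chain_def using ZV \<alpha> \<beta> 1 2 3 by blast
  then show ?thesis by blast
qed

section \<open>From a zig-zag chain to a uniform homeomorphism\<close>

lemma nested_dyballs_have_common_point:
  assumes u: "ultrametric U" and c: "mcomplete_of U" and \<beta>: "increasing_index \<beta>"
    and B: "\<And>n. n \<ge> 1 \<Longrightarrow> B n \<in> assoc_set U (\<beta> n)"
    and nest: "\<And>n. n \<ge> 1 \<Longrightarrow> B (Suc n) \<subseteq> B n"
  obtains p where "p \<in> mspace U" "\<And>n. n \<ge> 1 \<Longrightarrow> B n = dyball U (\<beta> n) p"
proof -
  interpret Metric_space "mspace U" "mdist U"
    by (rule Metric_space_mspace_mdist)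
  have "\<exists>x. x \<in> mspace U \<and> B n = dyball U (\<beta> n) x" if "n \<ge> 1" for n
    using B[OF that] unfolding assoc_set_eq_dyball by blast
  then obtain x where x: "\<And>n. n \<ge> 1 \<Longrightarrow> x n \<in> mspace U" "\<And>n. n \<ge> 1 \<Longrightarrow> B n = dyball U (\<beta> n) (x n)"
    by metis
  \<comment> \<open>Chains are indexed from 1, sequences from 0.\<close>
  define C where "C n = B (Suc n)" for n
  have C: "C n = mcball (x (Suc n)) (1 / 2 ^ \<beta> (Suc n))" for n
    using x(2) by (simp add: C_def dyball_def mcball_of_def)
  have small: "\<exists>n a. C n \<subseteq> mcball a e" if "e > 0" for e
  proof -
    obtain n where n: "n \<ge> 1" "\<And>m. m \<ge> n \<Longrightarrow> 1 / 2 ^ m < e"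
      using exists_dyadic_less[OF \<open>e > 0\<close>] by blast
    have "1 / 2 ^ \<beta> (Suc n) < e"
      using increasing_index_ge[OF \<beta>, of "Suc n"] n(2) by simp
    then have "C n \<subseteq> mcball (x (Suc n)) e"
      unfolding C by (intro mcball_subset_concentric) simp
    then show ?thesis by blast
  qed
  have "mcomplete"
    using c by (simp add: mcomplete_of_def)
  moreover have "\<forall>n. closedin mtopology (C n)"
    by (simp add: C)
  moreover have "\<forall>n. C n \<noteq> {}"
    using x(1)[of "Suc _"] by (fastforce simp: C)
  moreover have "decseq C"
    using nest by (simp add: decseq_Suc_iff C_def)
  ultimately obtain p where p: "p \<in> \<Inter> (range C)"
    using small unfolding mcomplete_nest by blast
  have mem: "p \<in> B n" if "n \<ge> 1" for n
  proof -
    have "p \<in> C (n - 1)"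
      using p by blast
    then show ?thesis
      using that by (simp add: C_def)
  qed
  show thesis
  proof (rule that)
    show "p \<in> mspace U"
      using mem[of 1] x(2)[of 1] by (simp add: dyball_def)
    show "B n = dyball U (\<beta> n) p" if "n \<ge> 1" for n
      using mem[OF that] x[OF that] dyball_eq_if_mem[OF u] by simp
  qed
qed

text \<open>
  Maps of balls that are compatible with refinement come from a point map: the images of the balls
  around \<open>x\<close> shrink to a point. Uniform continuity is automatic, since the level \<open>\<alpha> n\<close> ball of a
  point determines the level \<open>\<beta> n\<close> ball of its image.
\<close>

lemma ball_maps_induce_point_map:
  assumes u: "ultrametric U1" "ultrametric U2" and c: "mcomplete_of U2"
    and \<beta>: "increasing_index \<beta>"
    and v: "\<And>n x. n \<ge> 1 \<Longrightarrow> x \<in> mspace U1 \<Longrightarrow> v n (dyball U1 (\<alpha> n) x) \<in> assoc_set U2 (\<beta> n)"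
    and nest: "\<And>n x. n \<ge> 1 \<Longrightarrow> x \<in> mspace U1 \<Longrightarrow>
        v (Suc n) (dyball U1 (\<alpha> (Suc n)) x) \<subseteq> v n (dyball U1 (\<alpha> n) x)"
  obtains f where "uniformly_continuous_map U1 U2 f"
    "\<And>n x. n \<ge> 1 \<Longrightarrow> x \<in> mspace U1 \<Longrightarrow> v n (dyball U1 (\<alpha> n) x) = dyball U2 (\<beta> n) (f x)"
proof -
  have "\<exists>p. p \<in> mspace U2 \<and> (\<forall>n\<ge>1. v n (dyball U1 (\<alpha> n) x) = dyball U2 (\<beta> n) p)"
    if x: "x \<in> mspace U1" for x
    using nested_dyballs_have_common_point[OF u(2) c \<beta>, of "\<lambda>n. v n (dyball U1 (\<alpha> n) x)"]
      v[OF _ x] nest[OF _ x] by metis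
  then obtain f where f: "\<And>x. x \<in> mspace U1 \<Longrightarrow> f x \<in> mspace U2"
    "\<And>n x. n \<ge> 1 \<Longrightarrow> x \<in> mspace U1 \<Longrightarrow> v n (dyball U1 (\<alpha> n) x) = dyball U2 (\<beta> n) (f x)"
    by metis
  have "dyball U2 n (f x) = dyball U2 n (f y)"
    if xy: "x \<in> mspace U1" "y \<in> mspace U1"
      and eq: "dyball U1 (\<alpha> (Suc n)) x = dyball U1 (\<alpha> (Suc n)) y" for n x y
  proof -
    have "dyball U2 (\<beta> (Suc n)) (f x) = dyball U2 (\<beta> (Suc n)) (f y)"
      using f(2)[of "Suc n"] xy eq by (metis One_nat_def Suc_le_mono le0)
    moreover have "n \<le> \<beta> (Suc n)"
      using increasing_index_ge[OF \<beta>, of "Suc n"] by simp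
    ultimately show ?thesis
      using dyball_eq_coarser[OF u(2) f(1)[OF xy(1)] f(1)[OF xy(2)]] by blast
  qed
  then have "uniformly_continuous_map U1 U2 f"
    using uniformly_continuous_map_iff_dyball[OF u, of f] f(1) by blast
  then show thesis using f(2) by (rule that)
qed

lemma uniformly_homeomorphic_if_common_zigzag:
  fixes U1 :: "'a metric" and U2 :: "'b metric"
  assumes u: "ultrametric U1" "ultrametric U2" and c: "mcomplete_of U1" "mcomplete_of U2"
    and zz: "common_zigzag Z V (assoc_set U1) (assoc_map U1) (assoc_set U2) (assoc_map U2)"
  shows "uniformly_homeomorphic U1 U2"
proof -
  obtain \<alpha> \<beta> where \<alpha>: "increasing_index \<alpha>" and \<beta>: "increasing_index \<beta>"
    and sets: "\<forall>n\<ge>1. Z (2 * n - 1) = Inl ` assoc_set U1 (\<alpha> n) \<and> Z (2 * n) = Inr ` assoc_set U2 (\<beta> n)"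
    and VL: "\<forall>n\<ge>1. \<forall>B\<in>assoc_set U1 (\<alpha> (Suc n)).
       V (2 * n - 1) (V (2 * n) (Inl B)) = Inl (subchain_map \<alpha> (assoc_map U1) n B)"
    and VR: "\<forall>n\<ge>1. \<forall>B\<in>assoc_set U2 (\<beta> (Suc n)).
       V (2 * n) (V (2 * n + 1) (Inr B)) = Inr (subchain_map \<beta> (assoc_map U2) n B)"
    using zz unfolding common_zigzag_def subchain_set_def by (elim conjE exE)
  have ZL: "Z (2 * n - 1) = Inl ` assoc_set U1 (\<alpha> n)" and ZR: "Z (2 * n) = Inr ` assoc_set U2 (\<beta> n)"
    if "n \<ge> 1" for n
    using sets that by blast+
  have ZV: "V k ` Z (Suc k) = Z k" if "k \<ge> 1" for k
    using zz that by (simp add: common_zigzag_def D_minus_chain_def)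
  define v where "v n B = projr (V (2 * n) (Inl B))" for n B
  define w where "w n B = projl (V (2 * n - 1) (Inr B))" for n B
  have v: "V (2 * n) (Inl B) = Inr (v n B)" "v n B \<in> assoc_set U2 (\<beta> n)"
    if n: "n \<ge> 1" and B: "B \<in> assoc_set U1 (\<alpha> (Suc n))" for n B
  proof -
    have "Inl B \<in> Z (Suc (2 * n))"
      using ZL[of "Suc n"] B by simp
    then have "V (2 * n) (Inl B) \<in> Z (2 * n)"
      using ZV[of "2 * n"] n by auto
    then show "V (2 * n) (Inl B) = Inr (v n B)" "v n B \<in> assoc_set U2 (\<beta> n)"
      using ZR[OF n] by (auto simp: v_def)
  qed
  have w: "V (2 * n - 1) (Inr B) = Inl (w n B)" "w n B \<in> assoc_set U1 (\<alpha> n)"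
    if n: "n \<ge> 1" and B: "B \<in> assoc_set U2 (\<beta> n)" for n B
  proof -
    have "Suc (2 * n - 1) = 2 * n"
      using n by simp
    then have "Inr B \<in> Z (Suc (2 * n - 1))"
      using ZR[OF n] B by simp
    moreover have "V (2 * n - 1) ` Z (Suc (2 * n - 1)) = Z (2 * n - 1)"
      by (rule ZV) (use n in linarith)
    ultimately have "V (2 * n - 1) (Inr B) \<in> Z (2 * n - 1)"
      by blast
    then show "V (2 * n - 1) (Inr B) = Inl (w n B)" "w n B \<in> assoc_set U1 (\<alpha> n)"
      using ZL[OF n] by (auto simp: w_def)
  qed
  have in1: "dyball U1 n x \<in> assoc_set U1 n" if "x \<in> mspace U1" for n x
    using that by (simp add: assoc_set_eq_dyball)
  have in2: "dyball U2 n y \<in> assoc_set U2 n" if "y \<in> mspace U2" for n y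
    using that by (simp add: assoc_set_eq_dyball)
  have wv: "w n (v n (dyball U1 (\<alpha> (Suc n)) x)) = dyball U1 (\<alpha> n) x"
    if n: "n \<ge> 1" and x: "x \<in> mspace U1" for n x
    using VL[rule_format, OF n in1[OF x]] v[OF n in1[OF x]] w(1)[OF n v(2)[OF n in1[OF x]]]
      subchain_map_dyball[OF u(1) x, of \<alpha>] increasing_index_Suc_le[OF \<alpha> n] by simp
  have vw: "v n (w (Suc n) (dyball U2 (\<beta> (Suc n)) y)) = dyball U2 (\<beta> n) y"
    if n: "n \<ge> 1" and y: "y \<in> mspace U2" for n y
  proof -
    have Sn: "Suc n \<ge> 1" by simp
    show ?thesis
      using VR[rule_format, OF n in2[OF y]] w[OF Sn in2[OF y]] v(1)[OF n w(2)[OF Sn in2[OF y]]]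
        subchain_map_dyball[OF u(2) y, of \<beta>] increasing_index_Suc_le[OF \<beta> n] by simp
  qed
  \<comment> \<open>An image ball lies in the image of the coarser ball, because one full period of the zig-zag,
      applied to the image ball, enlarges it and yields that image.\<close>
  have v_nest: "v (Suc n) (dyball U1 (\<alpha> (Suc (Suc n))) x) \<subseteq> v n (dyball U1 (\<alpha> (Suc n)) x)"
    if n: "n \<ge> 1" and x: "x \<in> mspace U1" for n x
  proof -
    have Sn: "Suc n \<ge> 1" by simp
    obtain y where y: "y \<in> mspace U2"
      "v (Suc n) (dyball U1 (\<alpha> (Suc (Suc n))) x) = dyball U2 (\<beta> (Suc n)) y"
      using v(2)[OF Sn in1[OF x]] by (auto simp: assoc_set_eq_dyball)
    have "v n (dyball U1 (\<alpha> (Suc n)) x) = dyball U2 (\<beta> n) y"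
      using wv[OF Sn x] vw[OF n y(1)] y(2) by simp
    then show ?thesis
      using dyball_antimono[OF increasing_index_Suc_le[OF \<beta> n], of U2 y] y(2) by simp
  qed
  have w_nest: "w (Suc n) (dyball U2 (\<beta> (Suc n)) y) \<subseteq> w n (dyball U2 (\<beta> n) y)"
    if n: "n \<ge> 1" and y: "y \<in> mspace U2" for n y
  proof -
    have Sn: "Suc n \<ge> 1" by simp
    obtain x where x: "x \<in> mspace U1"
      "w (Suc n) (dyball U2 (\<beta> (Suc n)) y) = dyball U1 (\<alpha> (Suc n)) x"
      using w(2)[OF Sn in2[OF y]] by (auto simp: assoc_set_eq_dyball)
    have "w n (dyball U2 (\<beta> n) y) = dyball U1 (\<alpha> n) x"
      using vw[OF n y] wv[OF n x(1)] x(2) by simp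
    then show ?thesis
      using dyball_antimono[OF increasing_index_Suc_le[OF \<alpha> n], of U1 x] x(2) by simp
  qed
  obtain f where f_uc: "uniformly_continuous_map U1 U2 f"
    and f: "\<And>n x. n \<ge> 1 \<Longrightarrow> x \<in> mspace U1 \<Longrightarrow> v n (dyball U1 (\<alpha> (Suc n)) x) = dyball U2 (\<beta> n) (f x)"
    using ball_maps_induce_point_map[OF u c(2) \<beta>, of v "\<lambda>n. \<alpha> (Suc n)"] v(2)[OF _ in1] v_nest
    by metis
  obtain g where g_uc: "uniformly_continuous_map U2 U1 g"
    and g: "\<And>n y. n \<ge> 1 \<Longrightarrow> y \<in> mspace U2 \<Longrightarrow> w n (dyball U2 (\<beta> n) y) = dyball U1 (\<alpha> n) (g y)"
    using ball_maps_induce_point_map[OF u(2,1) c(1) \<alpha>, of w \<beta>] w(2)[OF _ in2] w_nest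
    by metis
  have f_in: "f x \<in> mspace U2" if "x \<in> mspace U1" for x
    using f_uc that by (auto simp: uniformly_continuous_map_def)
  have g_in: "g y \<in> mspace U1" if "y \<in> mspace U2" for y
    using g_uc that by (auto simp: uniformly_continuous_map_def)
  have gf: "g (f x) = x" if x: "x \<in> mspace U1" for x
  proof (rule eq_if_dyballs_eq[OF u(1) \<alpha> g_in[OF f_in[OF x]] x])
    fix n :: nat assume n: "n \<ge> 1"
    show "dyball U1 (\<alpha> n) (g (f x)) = dyball U1 (\<alpha> n) x"
      using g[OF n f_in[OF x]] f[OF n x] wv[OF n x] by simp
  qed
  have fg: "f (g y) = y" if y: "y \<in> mspace U2" for y
  proof (rule eq_if_dyballs_eq[OF u(2) \<beta> f_in[OF g_in[OF y]] y])
    fix n :: nat assume n: "n \<ge> 1"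
    show "dyball U2 (\<beta> n) (f (g y)) = dyball U2 (\<beta> n) y"
      using f[OF n g_in[OF y]] g[of "Suc n", OF _ y] vw[OF n y] by simp
  qed
  have bij: "bij_betw f (mspace U1) (mspace U2)"
    by (rule bij_betw_byWitness[of _ g]) (use gf fg f_in g_in in auto)
  have inv: "inv_into (mspace U1) f y = g y" if "y \<in> mspace U2" for y
    using bij that fg g_in by (metis bij_betw_def inv_into_f_f)
  have "uniformly_continuous_map U2 U1 (inv_into (mspace U1) f)"
    using g_uc by (simp add: uniformly_continuous_map_def Pi_iff inv)
  with bij f_uc show ?thesis
    unfolding uniformly_homeomorphic_def by blast
qed

theorem theorem5p7:
  fixes U1 :: "'a metric" and U2 :: "'b metric"
  assumes "ultrametric U1" and "mcomplete_of U1"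
    and "ultrametric U2" and "mcomplete_of U2"
  shows "uniformly_homeomorphic U1 U2 \<longleftrightarrow>
    (\<exists>Z V. common_zigzag Z V (assoc_set U1) (assoc_map U1) (assoc_set U2) (assoc_map U2))"
  using common_zigzag_if_uniformly_homeomorphic[OF assms(1,3)]
    uniformly_homeomorphic_if_common_zigzag[OF assms(1,3,2,4)] by blast

end
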